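(* Let $A$ be a generalized Cartan matrix with associated data $\mathfrak h_{\mathbb R}^*,\Pi,W,\overline C$, and let $\mu\in\overline C$. Let $I,I'\subseteq\Pi$ be $\mu$-connected and let $w,w'\in W$. Let $F_I=\operatorname{co}(W_I\mu)$ and $F_{I'}=\operatorname{co}(W_{I'}\mu)$. Then $wF_I\subseteq w'F_{I'}$ if and only if $I\subseteq I'$ and $w^{-1}w'\in W_{I_*}W_{I'}$; moreover, when $I\subseteq I'$, $W_{I_*}W_{I'}=W(F_I)W(F_{I'})$.
   Context: Let $A=(a_{ij})_{i,j=1}^m$ be a generalized Cartan matrix (integral, $a_{ii}=2$, $a_{ij}\le 0$ for $i\ne j$, $a_{ij}=0\Rightarrow a_{ji}=0$) of rank $l$. Let $(\mathfrak h_{\mathbb R},\Pi,\Pi^\vee)$ be a realization of $A$ over $\mathbb R$: $\mathfrak h_{\mathbb R}$ is a real vector space of dimension $2m-l$, and $\Pi=\{\alpha_1,\dots,\alpha_m\}\subset\mathfrak h_{\mathbb R}^*$ and $\Pi^\vee=\{\alpha_1^\vee,\dots,\alpha_m^\vee\}\subset\mathfrak h_{\mathbb R}$ are linearly independent with $\langle\alpha_j,\alpha_i^\vee\rangle=a_{ij}$. The Weyl group $W\subset GL(\mathfrak h_{\mathbb R}^* )$ is generated by the reflections $r_{\alpha_i}(\eta)=\eta-\langle\eta,\alpha_i^\vee\rangle\alpha_i$. For $I\subseteq\Pi$, $W_I$ is the subgroup generated by $r_\alpha$, $\alpha\in I$. The fundamental chamber is $\overline C=\{\eta\in\mathfrak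 h_{\mathbb R}^*\mid\langle\eta,\alpha^\vee\rangle\ge 0\ \forall\alpha\in\Pi\}$. Set $J_0=\{\alpha\in\Pi\mid\langle\mu,\alpha^\vee\rangle=0\}$. Connected components of a subset of $\Pi$ are taken in the Dynkin diagram of $A$ (distinct $\alpha,\beta\in\Pi$ are adjacent iff $\langle\alpha,\beta^\vee\rangle\ne 0$). A subset $I\subseteq\Pi$ is $\mu$-connected if no connected component of $I$ is contained in $J_0$ (the empty set is $\mu$-connected). For $\mu$-connected $I$, $I_*=\{\alpha\in J_0\setminus I\mid r_\alpha r_\beta=r_\beta r_\alpha\ \forall\beta\in I\}$. $\operatorname{co}$ denotes convex hull, and $W(F)=\{w\in W\mid wF=F\}$. *)

theory Defs
  imports "HOL-Analysis.Analysis" "HOL-Algebra.Generated_Groups"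
begin

text \<open>
  The real vector space of the realization is a type of class \<^class>\<open>euclidean_space\<close>.
  Its inner product is never used in a definition: the class only provides a real vector space of
  finite positive dimension, on which every linear functional is bounded, so that
  \<open>'h \<Rightarrow>\<^sub>L real\<close> is the full linear dual.

  The rows and columns of the matrix, the simple roots and the simple coroots are indexed by a
  finite type \<open>'n\<close>.  The simple roots of a realization are pairwise distinct, so a subset of
  \<open>\<Pi>\<close> is given by its set of indices.
\<close>

type_synonym 'h dual = "'h \<Rightarrow>\<^sub>L real"

definition gcm :: "int ^ 'n ^ 'n \<Rightarrow> bool" where
  "gcm A \<longleftrightarrow>
     (\<forall>i. A $ i $ i = 2) \<and>
     (\<forall>i j. i \<noteq> j \<longrightarrow> A $ i $ j \<le> 0) \<and>
     (\<forall>i j. A $ i $ j = 0 \<longrightarrow> A $ j $ i = 0)"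

text \<open>The first conjunct says that the dimension is \<open>2m - l\<close>, without truncated subtraction.\<close>

definition realization ::
    "int ^ 'n ^ 'n \<Rightarrow> ('n \<Rightarrow> 'h::euclidean_space dual) \<Rightarrow> ('n \<Rightarrow> 'h) \<Rightarrow> bool" where
  "realization A \<alpha> \<alpha>v \<longleftrightarrow>
     DIM('h) + rank (map_matrix real_of_int A) = 2 * CARD('n) \<and>
     inj \<alpha> \<and> independent (range \<alpha>) \<and>
     inj \<alpha>v \<and> independent (range \<alpha>v) \<and>
     (\<forall>i j. blinfun_apply (\<alpha> j) (\<alpha>v i) = real_of_int (A $ i $ j))"

definition GL :: "('v::real_vector \<Rightarrow> 'v) monoid" where
  "GL = \<lparr>carrier = {f. linear f \<and> bij f}, mult = (\<circ>), one = id\<rparr>"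

lemma group_GL: "group (GL :: ('v::real_vector \<Rightarrow> 'v) monoid)"
proof (rule groupI)
  fix f :: "'v \<Rightarrow> 'v"
  assume "f \<in> carrier GL"
  then have f: "linear f" "bij f"
    by (auto simp: GL_def)
  then have "linear (Hilbert_Choice.inv f)"
    by (intro linearI inv_f_eq)
      (simp_all add: bij_is_inj linear_add linear_scale surj_f_inv_f bij_is_surj)
  then have "Hilbert_Choice.inv f \<in> carrier GL"
    using f by (simp add: GL_def bij_imp_bij_inv)
  moreover have "Hilbert_Choice.inv f \<otimes>\<^bsub>GL\<^esub> f = \<one>\<^bsub>GL\<^esub>"
    using f by (simp add: GL_def bij_is_inj)
  ultimately show "\<exists>g\<in>carrier GL. g \<otimes>\<^bsub>GL\<^esub> f = \<one>\<^bsub>GL\<^esub>"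
    by blast
qed (simp_all add: GL_def linear_compose bij_comp comp_assoc linear_id[unfolded id_def[symmetric]])

definition simple_refl ::
    "('n \<Rightarrow> 'h::euclidean_space dual) \<Rightarrow> ('n \<Rightarrow> 'h) \<Rightarrow> 'n \<Rightarrow> 'h dual \<Rightarrow> 'h dual" where
  "simple_refl \<alpha> \<alpha>v i \<eta> = \<eta> - blinfun_apply \<eta> (\<alpha>v i) *\<^sub>R \<alpha> i"

lemma simple_refl_in_GL:
  assumes "gcm A" "realization A \<alpha> \<alpha>v"
  shows "simple_refl \<alpha> \<alpha>v i \<in> carrier GL"
proof -
  let ?r = "simple_refl \<alpha> \<alpha>v i"
  have "blinfun_apply (\<alpha> i) (\<alpha>v i) = 2"
    using assms by (auto simp: gcm_def realization_def)
  then have "?r \<circ> ?r = id"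
    by (auto simp: fun_eq_iff simple_refl_def blinfun.bilinear_simps)
  then have "bij ?r"
    by (rule o_bij) fact
  moreover have "linear ?r"
    by (rule linearI)
      (simp_all add: simple_refl_def blinfun.bilinear_simps scaleR_add_left scaleR_diff_right)
  ultimately show ?thesis
    by (simp add: GL_def)
qed

definition parabolic ::
    "('n \<Rightarrow> 'h::euclidean_space dual) \<Rightarrow> ('n \<Rightarrow> 'h) \<Rightarrow> 'n set \<Rightarrow> ('h dual \<Rightarrow> 'h dual) set" where
  "parabolic \<alpha> \<alpha>v I = generate GL (simple_refl \<alpha> \<alpha>v ` I)"

definition weyl ::
    "('n \<Rightarrow> 'h::euclidean_space dual) \<Rightarrow> ('n \<Rightarrow> 'h) \<Rightarrow> ('h dual \<Rightarrow> 'h dual) set" where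
  "weyl \<alpha> \<alpha>v = parabolic \<alpha> \<alpha>v UNIV"

definition fundamental_chamber :: "('n \<Rightarrow> 'h::euclidean_space) \<Rightarrow> 'h dual set" where
  "fundamental_chamber \<alpha>v = {\<eta>. \<forall>i. 0 \<le> blinfun_apply \<eta> (\<alpha>v i)}"

definition J0 :: "('n \<Rightarrow> 'h::euclidean_space) \<Rightarrow> 'h dual \<Rightarrow> 'n set" where
  "J0 \<alpha>v \<mu> = {i. blinfun_apply \<mu> (\<alpha>v i) = 0}"

definition dynkin_adj ::
    "('n \<Rightarrow> 'h::euclidean_space dual) \<Rightarrow> ('n \<Rightarrow> 'h) \<Rightarrow> 'n \<Rightarrow> 'n \<Rightarrow> bool" where
  "dynkin_adj \<alpha> \<alpha>v i j \<longleftrightarrow> i \<noteq> j \<and> blinfun_apply (\<alpha> i) (\<alpha>v j) \<noteq> 0"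

text \<open>
  For a generalized Cartan matrix the relation \<open>dynkin_adj\<close> is symmetric, so the reachability
  relation inside \<open>I\<close> is an equivalence relation, and its classes are the connected components
  of the subdiagram induced on \<open>I\<close>.
\<close>

definition dynkin_components ::
    "('n \<Rightarrow> 'h::euclidean_space dual) \<Rightarrow> ('n \<Rightarrow> 'h) \<Rightarrow> 'n set \<Rightarrow> 'n set set" where
  "dynkin_components \<alpha> \<alpha>v I = I // {(i, j). i \<in> I \<and> j \<in> I \<and> dynkin_adj \<alpha> \<alpha>v i j}\<^sup>*"

definition mu_connected ::
    "('n \<Rightarrow> 'h::euclidean_space dual) \<Rightarrow> ('n \<Rightarrow> 'h) \<Rightarrow> 'h dual \<Rightarrow> 'n set \<Rightarrow> bool" where
  "mu_connected \<alpha> \<alpha>v \<mu> I \<longleftrightarrow>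
     (\<forall>K \<in> dynkin_components \<alpha> \<alpha>v I. \<not> K \<subseteq> J0 \<alpha>v \<mu>)"

definition I_star ::
    "('n \<Rightarrow> 'h::euclidean_space dual) \<Rightarrow> ('n \<Rightarrow> 'h) \<Rightarrow> 'h dual \<Rightarrow> 'n set \<Rightarrow> 'n set" where
  "I_star \<alpha> \<alpha>v \<mu> I =
     {i \<in> J0 \<alpha>v \<mu> - I. \<forall>j\<in>I.
        simple_refl \<alpha> \<alpha>v i \<circ> simple_refl \<alpha> \<alpha>v j =
        simple_refl \<alpha> \<alpha>v j \<circ> simple_refl \<alpha> \<alpha>v i}"

definition face ::
    "('n \<Rightarrow> 'h::euclidean_space dual) \<Rightarrow> ('n \<Rightarrow> 'h) \<Rightarrow> 'h dual \<Rightarrow> 'n set \<Rightarrow> 'h dual set" where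
  "face \<alpha> \<alpha>v \<mu> I = convex hull ((\<lambda>u. u \<mu>) ` parabolic \<alpha> \<alpha>v I)"

definition set_stabilizer ::
    "('n \<Rightarrow> 'h::euclidean_space dual) \<Rightarrow> ('n \<Rightarrow> 'h) \<Rightarrow> 'h dual set \<Rightarrow> ('h dual \<Rightarrow> 'h dual) set" where
  "set_stabilizer \<alpha> \<alpha>v F = {w \<in> weyl \<alpha> \<alpha>v. w ` F = F}"

end

theory Submission
  imports Defs
begin

text \<open>
  With \<open>v = w\<inverse> w'\<close>, the question is when \<open>F\<^sub>I \<subseteq> v F\<^sub>I\<^sub>'\<close>. By Tits' lemma (proved by reduction to
  rank two) \<open>w\<close> sends a simple root to a nonnegative combination of simple roots unless the
  corresponding reflection shortens \<open>w\<close>. Hence a dominant \<open>\<mu>\<close> is an extreme point of the hull of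
  its orbit, and its stabilizer is generated by \<open>J\<^sub>0\<close>, so modulo \<open>W\<^sub>I\<^sub>'\<close> we may take \<open>v\<close> in
  \<open>W\<^sub>J\<^sub>0\<close> and of minimal length. The inverse of \<open>v\<close> maps the direction space of \<open>F\<^sub>I\<close>, spanned by
  \<open>I\<close>, into that of \<open>F\<^sub>I\<^sub>'\<close>; with minimality this forces \<open>v\<close> to fix the roots of \<open>I\<close> one after
  the other, starting outside \<open>J\<^sub>0\<close> and moving along the diagram, and \<open>v\<close> ends up in \<open>W\<^sub>I\<^sub>*\<close>.
\<close>

section \<open>Simple reflections, words and length\<close>

text \<open>Here \<open>'v\<close> plays the role of the dual space, and \<open>c i\<close> that of
  the pairing with the i-th simple coroot. Integrality of the numbers \<open>c i (a j)\<close> is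
  what leaves finitely many cases in the rank-two computation.\<close>

locale root_datum =
  fixes a :: "'n::finite \<Rightarrow> 'v::real_vector" and c :: "'n \<Rightarrow> 'v \<Rightarrow> real"
  assumes inj_a: "inj a" and indep_a: "independent (range a)"
    and linear_c: "linear (c i)"
    and c_same: "c i (a i) = 2"
    and c_int: "c i (a j) \<in> \<int>"
    and c_nonpos: "i \<noteq> j \<Longrightarrow> c i (a j) \<le> 0"
    and c_zero: "c i (a j) = 0 \<Longrightarrow> c j (a i) = 0"
begin

lemma c_simps [simp]:
  "c i (x + y) = c i x + c i y" "c i (x - y) = c i x - c i y"
  "c i (- x) = - c i x" "c i (t *\<^sub>R x) = t * c i x" "c i 0 = 0"
  using linear_c[of i]
  by (simp_all add: linear_add linear_diff linear_neg linear_scale linear_0)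

definition r :: "'n \<Rightarrow> 'v \<Rightarrow> 'v" where
  "r i x = x - c i x *\<^sub>R a i"

fun word :: "'n list \<Rightarrow> 'v \<Rightarrow> 'v" where
  "word [] = id"
| "word (i # xs) = r i \<circ> word xs"

text \<open>Words without inverses already form a group, because every \<open>r i\<close> is an
  involution.\<close>

definition W :: "'n set \<Rightarrow> ('v \<Rightarrow> 'v) set" where
  "W K = word ` lists K"

text \<open>The generating set is a parameter because the reduction to rank two compares lengths in
  \<open>W D\<close> and in \<open>W K\<close> for \<open>D\<close> inside \<open>K\<close>. The
  value is meaningful only for \<open>w\<close> in \<open>W K\<close>.\<close>

definition len :: "'n set \<Rightarrow> ('v \<Rightarrow> 'v) \<Rightarrow> nat" where
  "len K w = (LEAST n. \<exists>xs\<in>lists K. length xs = n \<and> word xs = w)"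

definition root_cone :: "'n set \<Rightarrow> 'v set" where
  "root_cone K = {\<Sum>i\<in>UNIV. f i *\<^sub>R a i |f. (\<forall>i. 0 \<le> f i) \<and> (\<forall>i. i \<notin> K \<longrightarrow> f i = 0)}"

lemma linear_r: "linear (r i)"
  by (rule linearI) (simp_all add: r_def scaleR_add_left scaleR_diff_right)

lemma r_r [simp]: "r i (r i x) = x"
  by (simp add: r_def c_same)

lemma r_comp_r [simp]: "r i \<circ> r i = id"
  by (simp add: fun_eq_iff)

lemma comp_r_comp_r [simp]: "w \<circ> r i \<circ> r i = w"
  by (simp add: fun_eq_iff)

lemma word_append: "word (xs @ ys) = word xs \<circ> word ys"
  by (induction xs) (simp_all add: comp_assoc)

lemma linear_word: "linear (word xs)"
proof (induction xs)
  case Nil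
  show ?case using linear_id by (simp add: id_def)
next
  case (Cons i xs)
  then show ?case unfolding word.simps by (rule linear_compose[OF _ linear_r])
qed

lemma word_rev: "word (rev xs) \<circ> word xs = id" "word xs \<circ> word (rev xs) = id"
  by (induction xs) (auto simp: word_append fun_eq_iff)

lemma linear_W: "w \<in> W K \<Longrightarrow> linear w"
  by (auto simp: W_def linear_word)

lemma W_mono: "K \<subseteq> L \<Longrightarrow> W K \<subseteq> W L"
  by (auto simp: W_def)

lemma id_in_W [simp]: "id \<in> W K"
  unfolding W_def by (rule image_eqI[of _ _ "[]"]) simp_all

lemma r_in_W: "i \<in> K \<Longrightarrow> r i \<in> W K"
  unfolding W_def by (rule image_eqI[of _ _ "[i]"]) simp_all

lemma W_comp: "\<lbrakk>v \<in> W K; w \<in> W K\<rbrakk> \<Longrightarrow> v \<circ> w \<in> W K"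
  by (auto simp: W_def word_append[symmetric] intro!: imageI)

lemma W_inverse:
  assumes "w \<in> W K"
  obtains v where "v \<in> W K" "v \<circ> w = id" "w \<circ> v = id"
proof -
  from assms obtain xs where xs: "set xs \<subseteq> K" "w = word xs"
    by (auto simp: W_def lists_eq_set)
  then have "word (rev xs) \<in> W K"
    by (auto simp: W_def lists_eq_set)
  then show thesis
    using that word_rev xs by blast
qed

lemma inj_W: "w \<in> W K \<Longrightarrow> inj w"
  by (metis W_inverse inj_on_id inj_on_imageI2)

lemma len_le: "xs \<in> lists K \<Longrightarrow> len K (word xs) \<le> length xs"
  unfolding len_def by (rule Least_le) auto

lemma reduced_word:
  assumes "w \<in> W K"
  obtains xs where "xs \<in> lists K" "word xs = w" "length xs = len K w"
proof -
  from assms have "\<exists>n. \<exists>xs\<in>lists K. length xs = n \<and> word xs = w"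
    by (auto simp: W_def)
  then have "\<exists>xs\<in>lists K. length xs = len K w \<and> word xs = w"
    unfolding len_def by (rule LeastI_ex)
  then show thesis using that by blast
qed

lemma len_comp:
  assumes "v \<in> W K" "w \<in> W K"
  shows "len K (v \<circ> w) \<le> len K v + len K w"
proof -
  obtain xs where xs: "xs \<in> lists K" "word xs = v" "length xs = len K v"
    using reduced_word[OF assms(1)] .
  obtain ys where ys: "ys \<in> lists K" "word ys = w" "length ys = len K w"
    using reduced_word[OF assms(2)] .
  from xs ys show ?thesis
    using len_le[of "xs @ ys" K] by (simp add: word_append)
qed

lemma len_r_le: "i \<in> K \<Longrightarrow> len K (r i) \<le> 1"
  using len_le[of "[i]" K] by simp

lemma len_anti_mono:
  assumes "K \<subseteq> L" "w \<in> W K"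
  shows "len L w \<le> len K w"
proof -
  obtain xs where "xs \<in> lists K" "word xs = w" "length xs = len K w"
    using reduced_word[OF assms(2)] .
  then show ?thesis using len_le[of xs L] assms(1) by auto
qed

text \<open>Cuts the last letter off a reduced word; the inductions on length below all use
  it.\<close>

lemma len_step:
  assumes "w \<in> W K" "w \<noteq> id"
  obtains v i where "v \<in> W K" "i \<in> K" "w = v \<circ> r i" "len K v < len K w"
proof -
  obtain xs where xs: "xs \<in> lists K" "word xs = w" "length xs = len K w"
    using reduced_word[OF assms(1)] .
  with assms(2) have "xs \<noteq> []" by auto
  then obtain ys i where ys: "xs = ys @ [i]"
    by (metis append_butlast_last_id)
  show thesis
  proof (rule that)
    show "word ys \<in> W K" "i \<in> K" using xs ys by (auto simp: W_def)
    show "w = word ys \<circ> r i" using xs ys by (auto simp: word_append)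
    show "len K (word ys) < len K w" using xs ys len_le[of ys K] by auto
  qed
qed

section \<open>Linear independence of the roots and the cones they span\<close>

lemma sum_a_eq_0: "(\<Sum>i\<in>UNIV. f i *\<^sub>R a i) = 0 \<Longrightarrow> f i = 0"
proof -
  assume 0: "(\<Sum>i\<in>UNIV. f i *\<^sub>R a i) = 0"
  have "(\<Sum>x\<in>range a. f (Hilbert_Choice.inv a x) *\<^sub>R x) = (\<Sum>i\<in>UNIV. f i *\<^sub>R a i)"
    by (simp add: sum.reindex[OF inj_a] inj_a)
  with 0 have "(\<Sum>x\<in>range a. f (Hilbert_Choice.inv a x) *\<^sub>R x) = 0" by simp
  from independentD[OF indep_a _ _ this, of "a i"] show "f i = 0"
    by (simp add: inj_a)
qed

lemma a_nonzero: "a i \<noteq> 0"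
  using indep_a dependent_zero by (metis rangeI)

lemma coneI: "\<lbrakk>\<And>i. 0 \<le> f i; \<And>i. i \<notin> K \<Longrightarrow> f i = 0\<rbrakk> \<Longrightarrow> (\<Sum>i\<in>UNIV. f i *\<^sub>R a i) \<in> root_cone K"
  unfolding root_cone_def by blast

lemma coneE:
  assumes "x \<in> root_cone K"
  obtains f where "x = (\<Sum>i\<in>UNIV. f i *\<^sub>R a i)" "\<And>i. 0 \<le> f i" "\<And>i. i \<notin> K \<Longrightarrow> f i = 0"
  using assms unfolding root_cone_def by blast

lemma cone_0 [simp]: "0 \<in> root_cone K"
  using coneI[of "\<lambda>_. 0"] by simp

lemma cone_add:
  assumes "x \<in> root_cone K" "y \<in> root_cone K"
  shows "x + y \<in> root_cone K"
proof -
  obtain f where f: "x = (\<Sum>i\<in>UNIV. f i *\<^sub>R a i)" "\<And>i. 0 \<le> f i" "\<And>i. i \<notin> K \<Longrightarrow> f i = 0"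
    by (rule coneE[OF assms(1)]) blast
  obtain g where g: "y = (\<Sum>i\<in>UNIV. g i *\<^sub>R a i)" "\<And>i. 0 \<le> g i" "\<And>i. i \<notin> K \<Longrightarrow> g i = 0"
    by (rule coneE[OF assms(2)]) blast
  have "(\<Sum>i\<in>UNIV. (f i + g i) *\<^sub>R a i) \<in> root_cone K"
    by (rule coneI) (simp_all add: f g)
  then show ?thesis by (simp add: f(1) g(1) scaleR_add_left sum.distrib)
qed

lemma cone_scale:
  assumes "x \<in> root_cone K" "0 \<le> t"
  shows "t *\<^sub>R x \<in> root_cone K"
proof -
  obtain f where f: "x = (\<Sum>i\<in>UNIV. f i *\<^sub>R a i)" "\<And>i. 0 \<le> f i" "\<And>i. i \<notin> K \<Longrightarrow> f i = 0"
    by (rule coneE[OF assms(1)]) blast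
  have "(\<Sum>i\<in>UNIV. (t * f i) *\<^sub>R a i) \<in> root_cone K"
    by (rule coneI) (simp_all add: f assms(2))
  then show ?thesis by (simp add: f(1) scaleR_sum_right)
qed

lemma cone_sum: "(\<And>i. i \<in> S \<Longrightarrow> f i \<in> root_cone K) \<Longrightarrow> sum f S \<in> root_cone K"
  by (induction S rule: infinite_finite_induct) (auto intro: cone_add)

lemma a_in_cone:
  assumes "i \<in> K"
  shows "a i \<in> root_cone K"
proof -
  have "(\<Sum>j\<in>UNIV. (if j = i then 1 else 0) *\<^sub>R a j) \<in> root_cone K"
    using assms by (intro coneI) auto
  then show ?thesis by (simp add: if_distrib[of "\<lambda>t. t *\<^sub>R _"] cong: if_cong)
qed

lemma cone_mono: "K \<subseteq> L \<Longrightarrow> root_cone K \<subseteq> root_cone L"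
  unfolding root_cone_def by blast

text \<open>By linear independence the coefficients of \<open>x\<close> and \<open>y\<close> add up
  to zero one by one. Later arguments use this to split a vanishing sum of cone elements into
  separate equations.\<close>

lemma cone_pointed:
  assumes "x \<in> root_cone K" "y \<in> root_cone L" "x + y = 0"
  shows "x = 0"
proof -
  obtain f where f: "x = (\<Sum>i\<in>UNIV. f i *\<^sub>R a i)" "\<And>i. 0 \<le> f i"
    by (rule coneE[OF assms(1)]) blast
  obtain g where g: "y = (\<Sum>i\<in>UNIV. g i *\<^sub>R a i)" "\<And>i. 0 \<le> g i"
    by (rule coneE[OF assms(2)]) blast
  have "(\<Sum>i\<in>UNIV. (f i + g i) *\<^sub>R a i) = 0"
    using assms(3) f(1) g(1) by (simp add: scaleR_add_left sum.distrib)
  then have "f i + g i = 0" for i using sum_a_eq_0[of "\<lambda>i. f i + g i"] by blast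
  then have "f i = 0" for i using f(2) g(2) by (metis add_nonneg_eq_0_iff)
  then show ?thesis using f(1) by simp
qed

section \<open>Rank two\<close>

lemma cone_pair:
  assumes "x \<in> root_cone {i, j}" "i \<noteq> j"
  obtains p q where "x = p *\<^sub>R a i + q *\<^sub>R a j" "0 \<le> p" "0 \<le> q"
proof -
  obtain f where f: "x = (\<Sum>i\<in>UNIV. f i *\<^sub>R a i)" "\<And>k. 0 \<le> f k" "\<And>k. k \<notin> {i, j} \<Longrightarrow> f k = 0"
    by (rule coneE[OF assms(1)]) blast
  have "x = (\<Sum>k\<in>{i, j}. f k *\<^sub>R a k)"
    unfolding f(1) by (rule sum.mono_neutral_right) (use f(3) in auto)
  then show thesis using that f(2) assms(2) by simp
qed

lemma pair_in_cone: "0 \<le> p \<Longrightarrow> 0 \<le> q \<Longrightarrow> p *\<^sub>R a i + q *\<^sub>R a j \<in> root_cone {i, j}"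
  by (intro cone_add cone_scale a_in_cone) auto

text \<open>\<open>alt i j n\<close> is the alternating word of length \<open>n\<close> in \<open>i\<close> and \<open>j\<close> whose last letter,
  the one acting first, is \<open>j\<close>.\<close>

fun alt :: "'n \<Rightarrow> 'n \<Rightarrow> nat \<Rightarrow> 'n list" where
  "alt i j 0 = []"
| "alt i j (Suc n) = alt j i n @ [j]"

lemma length_alt [simp]: "length (alt i j n) = n"
  by (induction n arbitrary: i j) auto

lemma set_alt: "set (alt i j n) \<subseteq> {i, j}"
proof (induction n arbitrary: i j)
  case (Suc n)
  from Suc[of j i] show ?case by auto
qed simp

text \<open>Reading from the right, each letter must differ from its neighbour, and only two letters
  are available.\<close>

lemma alt_unique:
  "distinct_adj (xs @ [i]) \<Longrightarrow> set xs \<subseteq> {i, j} \<Longrightarrow> xs = alt i j (length xs)"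
proof (induction xs arbitrary: i j rule: rev_induct)
  case (snoc x xs)
  then have "x = j" by (auto simp: distinct_adj_append_iff)
  with snoc show ?case
    using snoc.IH[of j i] by (auto simp: distinct_adj_append_iff)
qed simp

lemma alt_split: "m \<le> n \<Longrightarrow> \<exists>zs. set zs \<subseteq> {i, j} \<and> alt i j n = zs @ alt i j m"
proof (induction m arbitrary: n i j)
  case 0
  then show ?case using set_alt by auto
next
  case (Suc m)
  then obtain n' where n: "n = Suc n'" "m \<le> n'" by (metis Suc_le_D Suc_le_mono)
  from Suc.IH[OF n(2), of j i] obtain zs where "set zs \<subseteq> {j, i}" "alt j i n' = zs @ alt j i m"
    by blast
  with n(1) show ?case by (intro exI[of _ zs]) auto
qed

lemma r_pair:
  "r i (p *\<^sub>R a i + q *\<^sub>R a j) = (- c i (a j) * q - p) *\<^sub>R a i + q *\<^sub>R a j"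
  "r j (p *\<^sub>R a i + q *\<^sub>R a j) = p *\<^sub>R a i + (- c j (a i) * p - q) *\<^sub>R a j"
  by (simp_all add: r_def c_same algebra_simps scaleR_2 flip: scaleR_scaleR)

text \<open>The inequality \<open>2 q \<le> - c j (a i) p\<close> makes \<open>r j\<close> increase the coefficient of \<open>a j\<close>, and
  the hypothesis on the product of the Cartan integers turns it into the same inequality with
  \<open>i\<close> and \<open>j\<close> exchanged.\<close>

lemma alt_infinite:
  assumes "i \<noteq> j" "4 \<le> c i (a j) * c j (a i)"
    and "0 \<le> p" "0 \<le> q" "2 * q \<le> - c j (a i) * p"
  shows "word (alt i j n) (p *\<^sub>R a i + q *\<^sub>R a j) \<in> root_cone {i, j}"
  using assms
proof (induction n arbitrary: i j p q)
  case 0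
  then show ?case by (simp add: pair_in_cone)
next
  case (Suc n)
  define q' where "q' = - c j (a i) * p - q"
  have q': "q \<le> q'" "- c j (a i) * p \<le> 2 * q'" using Suc.prems by (auto simp: q'_def algebra_simps)
  have "c i (a j) \<le> 0" using Suc.prems c_nonpos by blast
  then have "- c i (a j) * (- c j (a i) * p) \<le> - c i (a j) * (2 * q')"
    using q'(2) by (intro mult_left_mono) auto
  moreover have "4 * p \<le> (c i (a j) * c j (a i)) * p"
    using Suc.prems by (intro mult_right_mono) auto
  ultimately have "2 * p \<le> - c i (a j) * q'" by (simp add: mult.assoc)
  then have "word (alt j i n) (q' *\<^sub>R a j + p *\<^sub>R a i) \<in> root_cone {j, i}"
    using Suc.prems q' by (intro Suc.IH) (auto simp: mult.commute)
  moreover have "r j (p *\<^sub>R a i + q *\<^sub>R a j) = q' *\<^sub>R a j + p *\<^sub>R a i"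
    by (simp add: r_pair q'_def)
  ultimately show ?case by (simp add: word_append insert_commute)
qed

text \<open>Modulo \<open>a i\<close> and \<open>a j\<close> the vector \<open>x\<close> does not
  move, so both reflections act as affine maps on two coefficients. This lets the braid relation be
  checked on an arbitrary vector, not only in the plane of the two roots.\<close>

lemma r_affine:
  "r i (x - p *\<^sub>R a i - q *\<^sub>R a j) = x - (c i x - p - c i (a j) * q) *\<^sub>R a i - q *\<^sub>R a j"
  "r j (x - p *\<^sub>R a i - q *\<^sub>R a j) = x - p *\<^sub>R a i - (c j x - q - c j (a i) * p) *\<^sub>R a j"
  by (simp_all add: r_def c_same algebra_simps scaleR_2 flip: scaleR_scaleR)

text \<open>The Coxeter number of the pair is 2, 3, 4 or 6 according to the product 0, 1, 2 or 3 of
  the Cartan integers.\<close>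

lemma alt_finite:
  assumes "i \<noteq> j" "c i (a j) * c j (a i) < 4"
  obtains m where "0 < m" "word (alt i j m) = word (alt j i m)"
    "\<And>n. n < m \<Longrightarrow> word (alt i j n) (a i) \<in> root_cone {i, j}"
proof -
  obtain A where A: "c i (a j) = real_of_int (- A)"
    using c_int[of i j] by (metis Ints_cases minus_minus)
  obtain B where B: "c j (a i) = real_of_int (- B)"
    using c_int[of j i] by (metis Ints_cases minus_minus)
  have "0 \<le> A" "0 \<le> B" using c_nonpos[of i j] c_nonpos[of j i] assms(1) A B by auto
  have AB: "A * B < 4" using assms(2) unfolding A B
    by (metis minus_mult_minus of_int_less_iff of_int_mult of_int_numeral)
  have zero: "A = 0 \<longleftrightarrow> B = 0" using c_zero[of i j] c_zero[of j i] A B by auto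
  have "A = 0 \<and> B = 0 \<or> A = 1 \<and> B = 1 \<or> A = 1 \<and> B = 2 \<or> A = 2 \<and> B = 1
      \<or> A = 1 \<and> B = 3 \<or> A = 3 \<and> B = 1"
  proof (cases "A = 0")
    case False
    then have "1 \<le> A" "1 \<le> B" using \<open>0 \<le> A\<close> \<open>0 \<le> B\<close> zero by auto
    then have "A * 1 \<le> A * B" "1 * B \<le> A * B"
      by (intro mult_left_mono mult_right_mono; simp)+
    then have "A = 1 \<or> A = 2 \<or> A = 3" "B = 1 \<or> B = 2 \<or> B = 3"
      using AB \<open>1 \<le> A\<close> \<open>1 \<le> B\<close> by linarith+
    then show ?thesis using AB by auto
  qed (use zero in auto)
  moreover define m :: nat where
    "m = (if A * B = 0 then 2 else if A * B = 1 then 3 else if A * B = 2 then 4 else 6)"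
  ultimately have cases: "A = 0 \<and> B = 0 \<and> m = 2 \<or> A = 1 \<and> B = 1 \<and> m = 3
      \<or> A = 1 \<and> B = 2 \<and> m = 4 \<or> A = 2 \<and> B = 1 \<and> m = 4
      \<or> A = 1 \<and> B = 3 \<and> m = 6 \<or> A = 3 \<and> B = 1 \<and> m = 6"
    by (elim disjE) simp_all
  have braid: "word (alt i j m) x = word (alt j i m) x" for x
  proof -
    \<comment> \<open>The two coefficients serve as coordinates, with \<open>x\<close> itself at
      \<open>F 0 0\<close>; in each case both alternating words are then evaluated by
      rewriting.\<close>
    define F where "F p q = x - p *\<^sub>R a i - q *\<^sub>R a j" for p q
    have r: "r i (F p q) = F (c i x - p + A * q) q" "r j (F p q) = F p (c j x - q + B * p)" for p q :: real
      by (simp_all add: F_def r_affine A B)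
    have "word (alt i j m) (F 0 0) = word (alt j i m) (F 0 0)"
      using cases by (elim disjE conjE) (simp_all add: numeral_eq_Suc word_append r add.commute)
    then show ?thesis by (simp add: F_def)
  qed
  have pos: "word (alt i j n) (a i) \<in> root_cone {i, j}" if "n < m" for n
  proof -
    define F where "F p q = p *\<^sub>R a i + q *\<^sub>R a j" for p q
    have r: "r i (F p q) = F (A * q - p) q" "r j (F p q) = F p (B * p - q)" for p q :: real
      by (simp_all add: F_def r_pair A B)
    have F: "F p q \<in> root_cone {i, j}" if "0 \<le> p" "0 \<le> q" for p q
      using that by (simp add: F_def pair_in_cone)
    have "n \<in> {0, 1, 2, 3, 4, 5}" using that cases by auto
    then have "word (alt i j n) (F 1 0) \<in> root_cone {i, j}"
      using cases that
      by (elim disjE conjE insertE emptyE) (simp_all add: numeral_eq_Suc word_append r F)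
    then show ?thesis by (simp add: F_def)
  qed
  show thesis
  proof (rule that)
    show "0 < m" using cases by auto
    show "word (alt i j m) = word (alt j i m)" using braid by (rule ext)
    show "word (alt i j n) (a i) \<in> root_cone {i, j}" if "n < m" for n
      using pos[OF that] .
  qed
qed

text \<open>Appending \<open>i\<close> to a reduced word of \<open>w\<close> creates no repeated
  neighbours, so the reduced word alternates and ends in \<open>j\<close>, unless it is empty. If
  the product of Cartan integers is at least 4, every alternating word keeps \<open>a i\<close> in
  the cone. Otherwise the word is shorter than the Coxeter number \<open>m\<close>, since from
  length \<open>m\<close> on the braid relation would make it end in \<open>i\<close>.\<close>

lemma dihedral:
  assumes "i \<noteq> j" "w \<in> W {i, j}" "len {i, j} w \<le> len {i, j} (w \<circ> r i)"
  shows "w (a i) \<in> root_cone {i, j}"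
proof -
  obtain xs where xs: "xs \<in> lists {i, j}" "word xs = w" "length xs = len {i, j} w"
    using reduced_word[OF assms(2)] .
  have min: "length xs \<le> length ys" if "ys \<in> lists {i, j}" "word ys = w" for ys
    using len_le[OF that(1)] that(2) xs(3) by simp
  \<comment> \<open>No word of \<open>w\<close> that is at most as long as \<open>xs\<close> ends in
    \<open>i\<close>: deleting that \<open>i\<close> would make \<open>w \<circ> r i\<close> shorter
    than \<open>w\<close>.\<close>
  have last: "\<not> (ys \<in> lists {i, j} \<and> word (ys @ [i]) = w \<and> length ys < length xs)" for ys
  proof
    assume *: "ys \<in> lists {i, j} \<and> word (ys @ [i]) = w \<and> length ys < length xs"
    then have "w \<circ> r i = word ys" by (auto simp: word_append)
    with * len_le[of ys "{i, j}"] assms(3) xs(3) show False by simp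
  qed
  have "distinct_adj (xs @ [i])"
  proof (rule ccontr)
    \<comment> \<open>A repeated pair inside \<open>xs\<close> cancels and contradicts minimality;
      if it involves the appended \<open>i\<close>, then \<open>xs\<close> itself ends in
      \<open>i\<close>.\<close>
    assume "\<not> distinct_adj (xs @ [i])"
    then obtain n where n: "Suc n < length (xs @ [i])" "(xs @ [i]) ! n = (xs @ [i]) ! Suc n"
      unfolding distinct_adj_conv_nth by blast
    then obtain us k vs where eq: "xs @ [i] = us @ [k, k] @ vs"
      using id_take_nth_drop[of n "xs @ [i]"] Cons_nth_drop_Suc[of "Suc n" "xs @ [i]"]
      by (metis Suc_lessD append_Cons append_Nil)
    show False
    proof (cases vs rule: rev_cases)
      case Nil
      with eq have "xs = us @ [i]" by simp
      with last[of us] xs show False by auto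
    next
      case (snoc vs' k')
      with eq have eq': "xs = us @ [k, k] @ vs'" by simp
      then have "word xs = word (us @ vs')" by (simp add: word_append fun_eq_iff)
      with min[of "us @ vs'"] xs eq' show False by auto
    qed
  qed
  then have alt: "xs = alt i j (length xs)"
    using xs(1) by (intro alt_unique) auto
  show ?thesis
  proof (cases "4 \<le> c i (a j) * c j (a i)")
    case True
    have "word (alt i j (length xs)) (1 *\<^sub>R a i + 0 *\<^sub>R a j) \<in> root_cone {i, j}"
      using assms(1) True c_nonpos[of j i] by (intro alt_infinite) auto
    then show ?thesis using alt xs(2) by simp
  next
    case False
    then obtain m where m: "0 < m" "word (alt i j m) = word (alt j i m)"
      "\<And>n. n < m \<Longrightarrow> word (alt i j n) (a i) \<in> root_cone {i, j}"
      using alt_finite[OF assms(1)] by (metis not_le)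
    have "length xs < m"
    proof (rule ccontr)
      assume "\<not> length xs < m"
      then obtain zs where zs: "set zs \<subseteq> {i, j}" "xs = zs @ alt i j m"
        using alt_split[of m "length xs" i j] alt by auto
      obtain m' where m': "m = Suc m'" using m(1) gr0_implies_Suc by blast
      \<comment> \<open>The braid relation replaces the final \<open>alt i j m\<close> by
        \<open>alt j i m\<close>, which is \<open>alt i j m' @ [i]\<close>.\<close>
      have "word ((zs @ alt i j m') @ [i]) = w"
        using xs(2) zs(2) m(2) by (simp add: word_append m' comp_assoc)
      then show False
        using last[of "zs @ alt i j m'"] zs set_alt[of i j m'] m' by auto
    qed
    from m(3)[OF this] show ?thesis using alt xs(2) by simp
  qed
qed

section \<open>Tits' lemma and its consequences for dominant vectors\<close>

text \<open>Write \<open>w = v \<circ> y\<close> with \<open>y\<close> in the dihedral group of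
  \<open>i\<close> and the last letter \<open>j\<close> of a reduced word, lengths adding up and
  \<open>v\<close> as short as possible. The rank-two case expresses \<open>y (a i)\<close> by
  \<open>a i\<close> and \<open>a j\<close> with nonnegative coefficients, and induction applies to
  \<open>v (a i)\<close> and \<open>v (a j)\<close>.\<close>

lemma W_root_positive:
  assumes "w \<in> W K" "i \<in> K" "len K w \<le> len K (w \<circ> r i)"
  shows "w (a i) \<in> root_cone K"
  using assms
proof (induction "len K w" arbitrary: w i rule: less_induct)
  case less
  show ?case
  proof (cases "w = id")
    case True
    then show ?thesis using less.prems by (simp add: a_in_cone)
  next
    case False
    obtain w1 j where w1: "w1 \<in> W K" "j \<in> K" "w = w1 \<circ> r j" "len K w1 < len K w"
      using len_step[OF less.prems(1) False] .
    have "i \<noteq> j" using w1 less.prems(3) by auto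
    define D where "D = {i, j}"
    have D: "D \<subseteq> K" using w1(2) less.prems(2) by (simp add: D_def)
    \<comment> \<open>\<open>P\<close> collects the admissible left factors. Since \<open>w1\<close>
      is one of them, with \<open>y = r j\<close>, a shortest one is shorter than
      \<open>w\<close>.\<close>
    define P where "P v \<longleftrightarrow> v \<in> W K \<and> (\<exists>y\<in>W D. w = v \<circ> y \<and> len K v + len D y \<le> len K w)" for v
    have P1: "P w1"
      using w1 len_r_le[of j D] r_in_W[of j D] unfolding P_def D_def by fastforce
    define v where "v = arg_min (len K) P"
    have v: "P v" "\<And>v'. P v' \<Longrightarrow> len K v \<le> len K v'"
      unfolding v_def using arg_min_nat_lemma[of P w1 "len K"] P1 by auto
    obtain y where y: "v \<in> W K" "y \<in> W D" "w = v \<circ> y" "len K v + len D y \<le> len K w"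
      using v(1) unfolding P_def by auto
    have pos: "v (a k) \<in> root_cone K" if "k \<in> D" for k
    proof (rule less.hyps)
      show "len K v < len K w" using v(2)[OF P1] w1(4) by simp
      show "v \<in> W K" "k \<in> K" using y(1) that D by auto
      show "len K v \<le> len K (v \<circ> r k)"
      proof (rule ccontr)
        \<comment> \<open>If \<open>r k\<close> shortened \<open>v\<close>, it could be moved from
          \<open>v\<close> to \<open>y\<close>, giving a shorter admissible left factor.\<close>
        assume *: "\<not> len K v \<le> len K (v \<circ> r k)"
        have "r k \<circ> y \<in> W D" "v \<circ> r k \<in> W K"
          using that D y r_in_W by (auto intro!: W_comp)
        moreover have "w = v \<circ> r k \<circ> (r k \<circ> y)" using y(3) by (simp add: fun_eq_iff)
        moreover have "len D (r k \<circ> y) \<le> 1 + len D y"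
          using len_comp[of "r k" D y] len_r_le[OF that] r_in_W[OF that] y(2) by linarith
        ultimately have "P (v \<circ> r k)" unfolding P_def using * y(4) by force
        from v(2)[OF this] * show False by simp
      qed
    qed
    \<comment> \<open>If \<open>r i\<close> shortened \<open>y\<close> inside \<open>W D\<close>, it
      would also shorten \<open>w\<close>.\<close>
    have "len D y \<le> len D (y \<circ> r i)"
    proof (rule ccontr)
      assume *: "\<not> len D y \<le> len D (y \<circ> r i)"
      have yr: "y \<circ> r i \<in> W D" using y(2) r_in_W by (auto simp: D_def intro!: W_comp)
      have "len K (w \<circ> r i) \<le> len K v + len K (y \<circ> r i)"
        using len_comp[of v K "y \<circ> r i"] y yr W_mono[OF D] by (auto simp: comp_assoc)
      also have "\<dots> \<le> len K v + len D (y \<circ> r i)" using len_anti_mono[OF D yr] by simp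
      finally show False using * y(4) less.prems(3) by simp
    qed
    then have "y (a i) \<in> root_cone {i, j}"
      using dihedral[OF \<open>i \<noteq> j\<close>] y(2) by (simp add: D_def)
    then obtain p q where pq: "y (a i) = p *\<^sub>R a i + q *\<^sub>R a j" "0 \<le> p" "0 \<le> q"
      using cone_pair \<open>i \<noteq> j\<close> by metis
    have "w (a i) = p *\<^sub>R v (a i) + q *\<^sub>R v (a j)"
      using y(3) pq(1) linear_W[OF y(1)] by (simp add: linear_add linear_scale)
    then show ?thesis using pos pq by (auto simp: D_def intro!: cone_add cone_scale)
  qed
qed

text \<open>For \<open>u = v \<circ> r i\<close> one has
  \<open>x - u x = (x - v x) + c i x *\<^sub>R v (a i)\<close>. The first term lies in the cone by
  induction and the second by Tits' lemma.\<close>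

lemma dominant_minus:
  assumes "u \<in> W K" "\<And>i. i \<in> K \<Longrightarrow> 0 \<le> c i x"
  shows "x - u x \<in> root_cone K"
  using assms(1)
proof (induction "len K u" arbitrary: u rule: less_induct)
  case less
  show ?case
  proof (cases "u = id")
    case False
    obtain v i where v: "v \<in> W K" "i \<in> K" "u = v \<circ> r i" "len K v < len K u"
      using len_step[OF less.prems False] .
    have "v (a i) \<in> root_cone K" using v by (intro W_root_positive) auto
    moreover have "x - u x = (x - v x) + c i x *\<^sub>R v (a i)"
      using linear_W[OF v(1)] by (simp add: v(3) r_def linear_diff linear_scale)
    moreover have "x - v x \<in> root_cone K" using less.hyps v by blast
    ultimately show ?thesis using assms(2)[OF v(2)] by (simp only: cone_add cone_scale)
  qed simp
qed

text \<open>In the same decomposition the two terms now sum to zero, so pointedness makes both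
  vanish. Hence \<open>v\<close> fixes \<open>x\<close> and the last letter satisfies
  \<open>c i x = 0\<close>.\<close>

lemma dominant_stabilizer:
  assumes "u \<in> W K" "\<And>i. i \<in> K \<Longrightarrow> 0 \<le> c i x" "u x = x"
  shows "u \<in> W {i \<in> K. c i x = 0}"
  using assms(1,3)
proof (induction "len K u" arbitrary: u rule: less_induct)
  case less
  show ?case
  proof (cases "u = id")
    case False
    obtain v i where v: "v \<in> W K" "i \<in> K" "u = v \<circ> r i" "len K v < len K u"
      using len_step[OF less.prems(1) False] .
    have "v (a i) \<in> root_cone K" using v by (intro W_root_positive) auto
    then have 1: "c i x *\<^sub>R v (a i) \<in> root_cone K" using assms(2)[OF v(2)] by (simp add: cone_scale)
    have 2: "x - u x = (x - v x) + c i x *\<^sub>R v (a i)"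
      using linear_W[OF v(1)] by (simp add: v(3) r_def linear_diff linear_scale)
    have 3: "x - v x \<in> root_cone K" by (rule dominant_minus) (use v assms in auto)
    have 4: "x - v x = 0" using cone_pointed[OF 3 1] 2 less.prems(2) by simp
    then have "c i x *\<^sub>R v (a i) = 0" using 2 less.prems(2) by simp
    moreover have "v (a i) \<noteq> 0"
      using inj_W[OF v(1)] linear_W[OF v(1)] a_nonzero by (metis injD linear_0)
    ultimately have "c i x = 0" by simp
    moreover have "v \<in> W {i \<in> K. c i x = 0}" using less.hyps v 4 by simp
    ultimately show ?thesis unfolding v(3) using v(2) by (intro W_comp r_in_W) auto
  qed simp
qed

text \<open>A shortest element of the coset \<open>v W L\<close> is not shortened on the right by
  any \<open>r j\<close> with \<open>j\<close> in \<open>L\<close>, so Tits' lemma applies to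
  it.\<close>

lemma minimal_coset_rep:
  assumes "v \<in> W K" "L \<subseteq> K"
  obtains b where "b \<in> W L" "\<And>j. j \<in> L \<Longrightarrow> (v \<circ> b) (a j) \<in> root_cone K"
proof -
  define b where "b = arg_min (\<lambda>b. len K (v \<circ> b)) (\<lambda>b. b \<in> W L)"
  have b: "b \<in> W L" "\<And>b'. b' \<in> W L \<Longrightarrow> len K (v \<circ> b) \<le> len K (v \<circ> b')"
    unfolding b_def using arg_min_nat_lemma[of "\<lambda>b. b \<in> W L" id "\<lambda>b. len K (v \<circ> b)"] by auto
  show thesis
  proof (rule that[OF b(1)])
    fix j assume j: "j \<in> L"
    have "b \<circ> r j \<in> W L" using b(1) r_in_W[OF j] by (rule W_comp)
    then have "len K (v \<circ> b) \<le> len K (v \<circ> b \<circ> r j)" using b(2) by (simp add: comp_assoc)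
    moreover have "v \<circ> b \<in> W K" using assms b(1) W_mono by (blast intro: W_comp)
    ultimately show "(v \<circ> b) (a j) \<in> root_cone K"
      using j assms(2) by (intro W_root_positive[of "v \<circ> b"]) (auto simp del: comp_apply)
  qed
qed

section \<open>Convex hulls of orbits\<close>

definition orbit_hull :: "'v \<Rightarrow> 'n set \<Rightarrow> 'v set" where
  "orbit_hull x K = convex hull ((\<lambda>u. u x) ` W K)"

lemma orbit_hull_mono: "K \<subseteq> L \<Longrightarrow> orbit_hull x K \<subseteq> orbit_hull x L"
  unfolding orbit_hull_def by (intro hull_mono image_mono W_mono)

lemma W_image_comp:
  assumes "w \<in> W K"
  shows "(\<lambda>u. w \<circ> u) ` W K = W K"
proof -
  obtain v where v: "v \<in> W K" "w \<circ> v = id" using W_inverse[OF assms] by blast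
  have "u \<in> (\<lambda>u. w \<circ> u) ` W K" if "u \<in> W K" for u
    using v that by (intro image_eqI[of _ _ "v \<circ> u"]) (auto simp flip: comp_assoc intro: W_comp)
  then show ?thesis using assms W_comp by blast
qed

lemma W_image_orbit_hull:
  assumes "w \<in> W K"
  shows "w ` orbit_hull x K = orbit_hull x K"
proof -
  have "w ` (\<lambda>u. u x) ` W K = (\<lambda>u. u x) ` (\<lambda>u. w \<circ> u) ` W K" by (simp add: image_image)
  then show ?thesis
    using W_image_comp[OF assms] linear_W[OF assms]
    by (simp add: orbit_hull_def convex_hull_linear_image)
qed

lemma W_minus_in_span:
  assumes "u \<in> W K"
  shows "x - u x \<in> span (a ` K)"
  using assms
proof (induction "len K u" arbitrary: u x rule: less_induct)
  case less
  show ?case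
  proof (cases "u = id")
    case False
    obtain v i where v: "v \<in> W K" "i \<in> K" "u = v \<circ> r i" "len K v < len K u"
      using len_step[OF less.prems False] .
    have "x - u x = (x - r i x) + (r i x - v (r i x))" by (simp add: v(3))
    moreover have "x - r i x \<in> span (a ` K)"
      using v(2) by (simp add: r_def span_base span_scale)
    moreover have "r i x - v (r i x) \<in> span (a ` K)" using less.hyps v by blast
    ultimately show ?thesis by (simp only: span_add)
  qed (simp add: span_zero)
qed

lemma orbit_hull_minus_in_span:
  assumes "y \<in> orbit_hull x K"
  shows "x - y \<in> span (a ` K)"
proof -
  have "convex {y. x - y \<in> span (a ` K)}"
  proof (rule convexI; safe)
    fix y z and s t :: real
    assume *: "x - y \<in> span (a ` K)" "x - z \<in> span (a ` K)" "s + t = 1"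
    have "x - (s *\<^sub>R y + t *\<^sub>R z) = (s + t) *\<^sub>R x - (s *\<^sub>R y + t *\<^sub>R z)"
      using *(3) by simp
    also have "\<dots> = s *\<^sub>R (x - y) + t *\<^sub>R (x - z)" by (simp add: algebra_simps)
    finally show "x - (s *\<^sub>R y + t *\<^sub>R z) \<in> span (a ` K)"
      using * by (simp only: span_add span_scale)
  qed
  moreover have "(\<lambda>u. u x) ` W K \<subseteq> {y. x - y \<in> span (a ` K)}"
    using W_minus_in_span by blast
  ultimately have "orbit_hull x K \<subseteq> {y. x - y \<in> span (a ` K)}"
    unfolding orbit_hull_def by (simp add: hull_minimal)
  then show ?thesis using assms by blast
qed

text \<open>Since the cone is pointed, the points below \<open>x\<close> in the cone order stay
  convex when \<open>x\<close> itself is removed. If \<open>x\<close> were not in \<open>T\<close>,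
  the whole hull would therefore miss \<open>x\<close>.\<close>

lemma extreme_point:
  assumes "x \<in> convex hull T" "\<And>y. y \<in> T \<Longrightarrow> x - y \<in> root_cone K"
  shows "x \<in> T"
proof (rule ccontr)
  assume "x \<notin> T"
  let ?D = "{y. x - y \<in> root_cone K \<and> y \<noteq> x}"
  have "convex ?D"
  proof (rule convexI)
    fix y z and s t :: real
    assume *: "y \<in> ?D" "z \<in> ?D" "0 \<le> s" "0 \<le> t" "s + t = 1"
    have "x - (s *\<^sub>R y + t *\<^sub>R z) = (s + t) *\<^sub>R x - (s *\<^sub>R y + t *\<^sub>R z)"
      using *(5) by simp
    also have "\<dots> = s *\<^sub>R (x - y) + t *\<^sub>R (x - z)" by (simp add: algebra_simps)
    finally have eq: "x - (s *\<^sub>R y + t *\<^sub>R z) = s *\<^sub>R (x - y) + t *\<^sub>R (x - z)" .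
    have cones: "s *\<^sub>R (x - y) \<in> root_cone K" "t *\<^sub>R (x - z) \<in> root_cone K"
      using * by (auto intro: cone_scale)
    have "s *\<^sub>R y + t *\<^sub>R z \<noteq> x"
    proof
      assume "s *\<^sub>R y + t *\<^sub>R z = x"
      then have 0: "s *\<^sub>R (x - y) + t *\<^sub>R (x - z) = 0" using eq by simp
      then have "s *\<^sub>R (x - y) = 0" using cone_pointed[OF cones] by simp
      moreover from this 0 have "t *\<^sub>R (x - z) = 0" by (metis add_0)
      ultimately show False using * by auto
    qed
    then show "s *\<^sub>R y + t *\<^sub>R z \<in> ?D" using cone_add[OF cones] eq by simp
  qed
  moreover have "T \<subseteq> ?D" using assms(2) \<open>x \<notin> T\<close> by blast
  ultimately have "convex hull T \<subseteq> ?D" by (simp add: hull_minimal)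
  then show False using assms(1) by blast
qed

section \<open>Inclusions between translated hulls\<close>

lemma sum_a_in_span:
  assumes "(\<Sum>i\<in>UNIV. f i *\<^sub>R a i) \<in> span (a ` K)" "i \<notin> K"
  shows "f i = 0"
proof -
  obtain g where "(\<Sum>i\<in>UNIV. f i *\<^sub>R a i) = (\<Sum>y\<in>a ` K. g y *\<^sub>R y)"
    using assms(1) span_finite[of "a ` K"] by auto
  also have "\<dots> = (\<Sum>i\<in>K. g (a i) *\<^sub>R a i)"
    by (rule sum.reindex_cong[of a]) (auto intro: inj_on_subset[OF inj_a])
  also have "\<dots> = (\<Sum>i\<in>UNIV. (if i \<in> K then g (a i) else 0) *\<^sub>R a i)"
    by (simp add: if_distrib[of "\<lambda>t. t *\<^sub>R _"] sum.If_cases cong: if_cong)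
  finally have "(\<Sum>i\<in>UNIV. (f i - (if i \<in> K then g (a i) else 0)) *\<^sub>R a i) = 0"
    by (simp add: scaleR_left_diff_distrib sum_subtractf)
  from sum_a_eq_0[OF this, of i] show ?thesis using assms(2) by simp
qed

text \<open>\<open>\<mu>\<close>-connectedness in the form of an induction principle, with \<open>\<mu> = x\<close>.\<close>

definition linked :: "'v \<Rightarrow> 'n set \<Rightarrow> bool" where
  "linked x I \<longleftrightarrow> (\<forall>P. (\<forall>i\<in>I. c i x \<noteq> 0 \<longrightarrow> i \<in> P) \<longrightarrow>
     (\<forall>k\<in>I \<inter> P. \<forall>i\<in>I. c i (a k) \<noteq> 0 \<longrightarrow> i \<in> P) \<longrightarrow> I \<subseteq> P)"

lemma linked_induct [consumes 2, case_names base step]: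
  assumes "linked x I" "i \<in> I"
    and "\<And>i. i \<in> I \<Longrightarrow> c i x \<noteq> 0 \<Longrightarrow> P i"
    and "\<And>k i. k \<in> I \<Longrightarrow> P k \<Longrightarrow> i \<in> I \<Longrightarrow> c i (a k) \<noteq> 0 \<Longrightarrow> P i"
  shows "P i"
proof -
  have "I \<subseteq> Collect P"
    using assms(1)[unfolded linked_def, THEN spec, of "Collect P"] assms(3,4) by blast
  then show ?thesis using assms(2) by blast
qed

text \<open>The span is stable under \<open>r i\<close> for \<open>i\<close> in \<open>I\<close>,
  and \<open>x - r i x\<close> is a multiple of \<open>a i\<close>. Once it contains
  \<open>a k\<close>, it contains \<open>a k - r i (a k)\<close>, which is a nonzero multiple of
  \<open>a i\<close> whenever \<open>i\<close> is linked to \<open>k\<close>.\<close>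

lemma a_in_span_orbit:
  assumes "linked x I" "i \<in> I"
  shows "a i \<in> span ((\<lambda>u. x - u x) ` W I)"
  using assms
proof (induction rule: linked_induct)
  case (base i)
  have "x - r i x \<in> span ((\<lambda>u. x - u x) ` W I)"
    using r_in_W[OF base(1)] by (intro span_base) auto
  then have "c i x *\<^sub>R a i \<in> span ((\<lambda>u. x - u x) ` W I)" by (simp add: r_def)
  from span_scale[OF this, of "inverse (c i x)"] show ?case using base(2) by simp
next
  case (step k i)
  let ?S = "span ((\<lambda>u. x - u x) ` W I)"
  have "r i ` ((\<lambda>u. x - u x) ` W I) \<subseteq> ?S"
  proof safe
    fix u assume "u \<in> W I"
    then have "r i \<circ> u \<in> W I" using r_in_W[OF step.hyps(2)] by (intro W_comp)
    then have "x - (r i \<circ> u) x \<in> ?S" "x - r i x \<in> ?S"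
      using r_in_W[OF step.hyps(2)] by (blast intro: span_base)+
    then have "(x - (r i \<circ> u) x) - (x - r i x) \<in> ?S" by (rule span_diff)
    moreover have "r i (x - u x) = (x - (r i \<circ> u) x) - (x - r i x)"
      by (simp add: linear_diff[OF linear_r])
    ultimately show "r i (x - u x) \<in> ?S" by simp
  qed
  then have "r i ` ?S \<subseteq> ?S"
    by (metis linear_span_image[OF linear_r] span_mono span_span)
  with step.IH have "r i (a k) \<in> ?S" by blast
  with step.IH have "a k - r i (a k) \<in> ?S" by (rule span_diff)
  then have "c i (a k) *\<^sub>R a i \<in> ?S" by (simp add: r_def)
  from span_scale[OF this, of "inverse (c i (a k))"] show ?case using step.hyps(3) by simp
qed

text \<open>Let \<open>v\<close> be minimal in its coset modulo \<open>W (I' \<inter> J0)\<close> with inverse \<open>u\<close>, and let \<open>J\<close> be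
  minimal with \<open>u \<in> W J\<close>. For \<open>i \<notin> J\<close>, the vector \<open>- a i\<close> is dominant for \<open>J\<close>, so
  \<open>u (a i) - a i\<close> and \<open>v (a i) - a i\<close> are nonnegative combinations of simple roots. If
  \<open>u (a i)\<close> lies in the span of \<open>a ` I'\<close>, minimality of \<open>v\<close> forces these combinations to cancel.
  So \<open>u\<close> fixes \<open>a i\<close>, and minimality of \<open>J\<close> makes \<open>J\<close> orthogonal to \<open>i\<close>. Connectivity
  propagates \<open>i \<notin> J\<close> through \<open>I\<close>.\<close>

lemma orbit_hull_subset_fixing:
  assumes link: "linked x I" and v: "v \<in> W {i. c i x = 0}"
    and sub: "orbit_hull x I \<subseteq> v ` orbit_hull x I'"
    and pos: "\<And>j. j \<in> I' \<Longrightarrow> c j x = 0 \<Longrightarrow> v (a j) \<in> root_cone UNIV"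
  obtains J where "v \<in> W J" "I \<subseteq> I'" "\<And>j. j \<in> J \<Longrightarrow> c j x = 0" "I \<inter> J = {}"
    "\<And>i j. i \<in> I \<Longrightarrow> j \<in> J \<Longrightarrow> c j (a i) = 0"
proof -
  let ?J0 = "{i. c i x = 0}"
  define J where "J = arg_min card (\<lambda>J. J \<subseteq> ?J0 \<and> v \<in> W J)"
  have J: "J \<subseteq> ?J0" "v \<in> W J" "\<And>K. K \<subseteq> ?J0 \<Longrightarrow> v \<in> W K \<Longrightarrow> card J \<le> card K"
    unfolding J_def using arg_min_nat_lemma[of "\<lambda>J. J \<subseteq> ?J0 \<and> v \<in> W J" ?J0 card] v by auto
  obtain u where u: "u \<in> W J" "u \<circ> v = id" "v \<circ> u = id" using W_inverse[OF J(2)] .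
  have uv: "u (v y) = y" "v (u y) = y" for y using u(2,3) by (simp_all add: fun_eq_iff)
  have fix_x: "u' x = x" if u': "u' \<in> W J" for u'
  proof -
    have "word xs x = x" if "set xs \<subseteq> J" for xs
      using that J(1) by (induction xs) (auto simp: r_def)
    then show ?thesis using u' by (auto simp: W_def lists_eq_set)
  qed
  \<comment> \<open>Since \<open>u\<close> fixes \<open>x\<close>, it maps \<open>x - t x\<close> to
    \<open>x - y\<close> with \<open>y\<close> in \<open>orbit_hull x I'\<close>. Thus it carries
    the directions of the first hull into those of the second.\<close>
  have span: "u (a i) \<in> span (a ` I')" if "i \<in> I" for i
  proof -
    have "u ` (\<lambda>t. x - t x) ` W I \<subseteq> span (a ` I')"
    proof safe
      fix t assume "t \<in> W I"
      then have "t x \<in> orbit_hull x I" unfolding orbit_hull_def by (blast intro: hull_inc)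
      then obtain y where y: "y \<in> orbit_hull x I'" "t x = v y" using sub by blast
      have "u (x - t x) = x - y"
        using fix_x[OF u(1)] y(2) uv linear_diff[OF linear_W[OF u(1)]] by simp
      then show "u (x - t x) \<in> span (a ` I')" using orbit_hull_minus_in_span[OF y(1)] by simp
    qed
    then have "u ` span ((\<lambda>t. x - t x) ` W I) \<subseteq> span (a ` I')"
      by (metis linear_span_image[OF linear_W[OF u(1)]] span_mono span_span)
    then show ?thesis using a_in_span_orbit[OF link that] by blast
  qed
  have cone: "u' (a i) - a i \<in> root_cone J" if "u' \<in> W J" "i \<notin> J" for u' i
  proof -
    have "- a i - u' (- a i) \<in> root_cone J"
    proof (rule dominant_minus[OF that(1)])
      fix j assume "j \<in> J"
      then have "j \<noteq> i" using that(2) by auto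
      then show "0 \<le> c j (- a i)" using c_nonpos[of j i] by simp
    qed
    then show ?thesis by (simp add: linear_neg[OF linear_W[OF that(1)]])
  qed
  have key: "i \<in> I' \<and> u (a i) = a i" if i: "i \<in> I" "i \<notin> J" for i
  proof -
    obtain f where f: "u (a i) - a i = (\<Sum>j\<in>UNIV. f j *\<^sub>R a j)" "\<And>j. 0 \<le> f j"
      "\<And>j. j \<notin> J \<Longrightarrow> f j = 0"
      using coneE[OF cone[OF u(1) i(2)]] by blast
    have "u (a i) = a i + (\<Sum>j\<in>UNIV. f j *\<^sub>R a j)" using f(1) by (simp add: algebra_simps)
    also have "\<dots> = (\<Sum>j\<in>UNIV. ((if j = i then 1 else 0) + f j) *\<^sub>R a j)"
      by (simp add: scaleR_add_left sum.distrib if_distrib[of "\<lambda>t. t *\<^sub>R _"] cong: if_cong)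
    \<comment> \<open>As \<open>i\<close> is not in \<open>J\<close>, the coefficient of
      \<open>a i\<close> is exactly 1, which forces \<open>i \<in> I'\<close>; every other
      \<open>j\<close> with \<open>f j \<noteq> 0\<close> must also be in \<open>I'\<close>.\<close>
    finally have coeff: "(if j = i then 1 else 0) + f j = 0" if "j \<notin> I'" for j
      using sum_a_in_span[of "\<lambda>j. (if j = i then 1 else 0) + f j" I' j] span[OF i(1)] that by simp
    have "i \<in> I'"
    proof (rule ccontr)
      assume "i \<notin> I'"
      with coeff[of i] f(2)[of i] show False by simp
    qed
    have "v (u (a i) - a i) = (\<Sum>j\<in>UNIV. f j *\<^sub>R v (a j))"
      using linear_W[OF J(2)] by (simp add: f(1) linear_sum linear_scale)
    also have "\<dots> \<in> root_cone UNIV"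
    proof (rule cone_sum)
      fix j
      show "f j *\<^sub>R v (a j) \<in> root_cone UNIV"
      proof (cases "f j = 0")
        case False
        then have "j \<in> J" using f(3) by blast
        moreover have "j \<in> I'"
        proof (rule ccontr)
          assume "j \<notin> I'"
          moreover have "j \<noteq> i" using \<open>j \<in> J\<close> i(2) by blast
          ultimately show False using coeff[of j] False by simp
        qed
        ultimately show ?thesis using pos J(1) f(2) by (auto intro: cone_scale)
      qed simp
    qed
    finally have 1: "a i - v (a i) \<in> root_cone UNIV"
      using linear_diff[OF linear_W[OF J(2)]] uv by simp
    have "v (a i) - a i = 0" using cone_pointed[OF cone[OF J(2) i(2)] 1] by simp
    then have "u (a i) = a i" using uv by (metis eq_iff_diff_eq_0)
    with \<open>i \<in> I'\<close> show ?thesis by blast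
  qed
  have orth: "c j (a i) = 0" if "i \<in> I" "i \<notin> J" "j \<in> J" for i j
  proof -
    \<comment> \<open>\<open>- a i\<close> is dominant for \<open>J\<close> and fixed by
      \<open>v\<close>, so \<open>v\<close> needs only those reflections in \<open>J\<close> that
      are orthogonal to \<open>a i\<close>; by minimality these are all of \<open>J\<close>.\<close>
    have "v (- a i) = - a i"
      using key[OF that(1,2)] uv linear_neg[OF linear_W[OF J(2)]] by metis
    moreover have "0 \<le> c k (- a i)" if "k \<in> J" for k
    proof -
      have "k \<noteq> i" using that \<open>i \<notin> J\<close> by auto
      then show ?thesis using c_nonpos[of k i] by simp
    qed
    ultimately have "v \<in> W {k \<in> J. c k (- a i) = 0}" using dominant_stabilizer[OF J(2)] by blast
    then have "card J \<le> card {k \<in> J. c k (- a i) = 0}" using J(1) by (intro J(3)) auto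
    then have "{k \<in> J. c k (- a i) = 0} = J" by (intro card_seteq) auto
    then show ?thesis using that(3) by auto
  qed
  have disj: "i \<notin> J" if "i \<in> I" for i
    using link that
  proof (induction rule: linked_induct)
    case (base i)
    then show ?case using J(1) by auto
  next
    case (step k i)
    then show ?case using orth by blast
  qed
  show thesis
    by (rule that[of J]) (use J key orth disj in auto)
qed

text \<open>The point \<open>x\<close> is extreme, so it lies in the translated orbit and some
  \<open>b\<close> in \<open>W I'\<close> gives \<open>v \<circ> b\<close> fixing \<open>x\<close>.
  A further factor \<open>b'\<close> makes the element minimal modulo the part of \<open>I'\<close>
  orthogonal to \<open>x\<close>. Both factors preserve \<open>orbit_hull x I'\<close>, and the
  inverse of their product becomes \<open>t\<close>.\<close>

lemma orbit_hull_subset: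
  assumes dom: "\<And>i. 0 \<le> c i x" and link: "linked x I"
    and v: "v \<in> W UNIV" and sub: "orbit_hull x I \<subseteq> v ` orbit_hull x I'"
  obtains J s t where "v = s \<circ> t" "s \<in> W J" "t \<in> W I'" "I \<subseteq> I'" "\<And>j. j \<in> J \<Longrightarrow> c j x = 0"
    "I \<inter> J = {}" "\<And>i j. i \<in> I \<Longrightarrow> j \<in> J \<Longrightarrow> c j (a i) = 0"
proof -
  let ?J0 = "{i. c i x = 0}"
  have I': "W I' \<subseteq> W UNIV" by (rule W_mono) simp
  have "x \<in> orbit_hull x I"
    unfolding orbit_hull_def by (rule hull_inc) (rule image_eqI[of _ _ id], simp_all)
  then have "x \<in> convex hull (v ` (\<lambda>u. u x) ` W I')"
    using sub convex_hull_linear_image[OF linear_W[OF v]] unfolding orbit_hull_def by blast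
  then have "x \<in> v ` (\<lambda>u. u x) ` W I'"
  proof (rule extreme_point)
    fix y assume "y \<in> v ` (\<lambda>u. u x) ` W I'"
    then obtain u where "u \<in> W I'" "y = (v \<circ> u) x" by auto
    then show "x - y \<in> root_cone UNIV"
      using I' v dom by (auto intro!: dominant_minus[of "v \<circ> u" UNIV x, simplified] W_comp)
  qed
  then obtain b where b: "b \<in> W I'" "(v \<circ> b) x = x" by auto
  have "v \<circ> b \<in> W UNIV" using I' v b(1) by (auto intro: W_comp)
  then have vb: "v \<circ> b \<in> W ?J0" 
    using dominant_stabilizer[of "v \<circ> b" UNIV x] dom b(2) by (simp del: comp_apply)
  obtain b' where b': "b' \<in> W (I' \<inter> ?J0)"
    "\<And>j. j \<in> I' \<inter> ?J0 \<Longrightarrow> (v \<circ> b \<circ> b') (a j) \<in> root_cone ?J0"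
    using minimal_coset_rep[OF vb, of "I' \<inter> ?J0"] by blast
  let ?v = "v \<circ> b \<circ> b'"
  have mono: "W (I' \<inter> ?J0) \<subseteq> W I'" "W (I' \<inter> ?J0) \<subseteq> W ?J0" by (rule W_mono, blast)+
  have bb': "b \<circ> b' \<in> W I'" using b(1) b'(1) mono by (blast intro: W_comp)
  have v': "?v \<in> W ?J0" using vb b'(1) mono by (blast intro: W_comp)
  have "?v ` orbit_hull x I' = v ` (b \<circ> b') ` orbit_hull x I'" by (simp add: image_comp comp_assoc)
  then have sub': "orbit_hull x I \<subseteq> ?v ` orbit_hull x I'"
    using sub by (simp only: W_image_orbit_hull[OF bb'])
  have pos: "?v (a j) \<in> root_cone UNIV" if "j \<in> I'" "c j x = 0" for j
    using b'(2)[of j] that cone_mono[of ?J0 UNIV] by auto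
  obtain J where J: "?v \<in> W J" "I \<subseteq> I'" "\<And>j. j \<in> J \<Longrightarrow> c j x = 0" "I \<inter> J = {}"
    "\<And>i j. i \<in> I \<Longrightarrow> j \<in> J \<Longrightarrow> c j (a i) = 0"
    using orbit_hull_subset_fixing[OF link v' sub' pos] by blast
  obtain t where t: "t \<in> W I'" "b \<circ> b' \<circ> t = id" using W_inverse[OF bb'] by blast
  have "v = ?v \<circ> t" using t(2) by (simp add: comp_assoc)
  then show thesis using that J t(1) by blast
qed

end

section \<open>Transfer to the given realization\<close>

text \<open>The component of \<open>i\<close> contains some \<open>k\<close> outside
  \<open>J0\<close>, and \<open>P\<close> is carried back along a path from \<open>k\<close> to
  \<open>i\<close>. Going backwards along edges is why symmetry of the adjacency is a
  premise.\<close>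

lemma mu_connected_induct [consumes 2, case_names base step]:
  assumes "mu_connected \<alpha> \<alpha>v \<mu> I" "i \<in> I"
    and sym: "\<And>i j. dynkin_adj \<alpha> \<alpha>v i j \<Longrightarrow> dynkin_adj \<alpha> \<alpha>v j i"
    and base: "\<And>i. i \<in> I \<Longrightarrow> i \<notin> J0 \<alpha>v \<mu> \<Longrightarrow> P i"
    and step: "\<And>k i. k \<in> I \<Longrightarrow> P k \<Longrightarrow> i \<in> I \<Longrightarrow> dynkin_adj \<alpha> \<alpha>v k i \<Longrightarrow> P i"
  shows "P i"
proof -
  let ?R = "{(i, j). i \<in> I \<and> j \<in> I \<and> dynkin_adj \<alpha> \<alpha>v i j}"
  have "?R\<^sup>* `` {i} \<in> dynkin_components \<alpha> \<alpha>v I"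
    unfolding dynkin_components_def using assms(2) by (rule quotientI)
  then obtain k where k: "(i, k) \<in> ?R\<^sup>*" "k \<notin> J0 \<alpha>v \<mu>"
    using assms(1) unfolding mu_connected_def by blast
  have "k \<in> I" using k(1) assms(2) by (induction rule: rtrancl_induct) auto
  from k(1) show ?thesis
  proof (induction rule: converse_rtrancl_induct)
    case base
    show ?case using assms(4) \<open>k \<in> I\<close> k(2) by blast
  next
    case (step y z)
    then show ?case using assms(5)[of z y] sym by auto
  qed
qed

theorem proposition3p16:
  fixes A :: "int ^ 'n ^ 'n"
    and \<alpha> :: "'n \<Rightarrow> 'h::euclidean_space dual"
    and \<alpha>v :: "'n \<Rightarrow> 'h"
    and \<mu> :: "'h dual"
    and I I' :: "'n set"
    and w w' :: "'h dual \<Rightarrow> 'h dual"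
  assumes "gcm A"
    and "realization A \<alpha> \<alpha>v"
    and "\<mu> \<in> fundamental_chamber \<alpha>v"
    and "mu_connected \<alpha> \<alpha>v \<mu> I"
    and "mu_connected \<alpha> \<alpha>v \<mu> I'"
    and "w \<in> weyl \<alpha> \<alpha>v"
    and "w' \<in> weyl \<alpha> \<alpha>v"
  shows "(w ` face \<alpha> \<alpha>v \<mu> I \<subseteq> w' ` face \<alpha> \<alpha>v \<mu> I' \<longleftrightarrow>
           I \<subseteq> I' \<and>
           inv\<^bsub>GL\<^esub> w \<otimes>\<^bsub>GL\<^esub> w' \<in>
             parabolic \<alpha> \<alpha>v (I_star \<alpha> \<alpha>v \<mu> I) <#>\<^bsub>GL\<^esub> parabolic \<alpha> \<alpha>v I') \<and>
         (I \<subseteq> I' \<longrightarrow>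
           parabolic \<alpha> \<alpha>v (I_star \<alpha> \<alpha>v \<mu> I) <#>\<^bsub>GL\<^esub> parabolic \<alpha> \<alpha>v I' =
           set_stabilizer \<alpha> \<alpha>v (face \<alpha> \<alpha>v \<mu> I) <#>\<^bsub>GL\<^esub>
           set_stabilizer \<alpha> \<alpha>v (face \<alpha> \<alpha>v \<mu> I'))"
proof -
  interpret D: root_datum \<alpha> "\<lambda>i \<eta>. blinfun_apply \<eta> (\<alpha>v i)"
    using assms(1,2)
    by unfold_locales (auto simp: gcm_def realization_def blinfun.bilinear_simps intro!: linearI)
  have r: "D.r = simple_refl \<alpha> \<alpha>v"
    by (intro ext) (simp add: D.r_def simple_refl_def)
  have mult: "f \<otimes>\<^bsub>GL\<^esub> g = f \<circ> g" for f g :: "'h dual \<Rightarrow> 'h dual" by (simp add: GL_def)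
  have GL_one: "\<one>\<^bsub>GL\<^esub> = (id :: 'h dual \<Rightarrow> 'h dual)" by (simp add: GL_def)
  \<comment> \<open>A generated subgroup also admits inverses of generators, but a reflection is its
    own inverse, so only words remain.\<close>
  have W: "parabolic \<alpha> \<alpha>v K = D.W K" for K
  proof (intro equalityI subsetI)
    fix u assume "u \<in> parabolic \<alpha> \<alpha>v K"
    then show "u \<in> D.W K" unfolding parabolic_def
    proof (induction rule: generate.induct)
      case one
      then show ?case by (simp only: GL_one D.id_in_W)
    next
      case (incl h)
      then show ?case using D.r_in_W by (auto simp: r)
    next
      case (inv h)
      then obtain i where i: "i \<in> K" "h = D.r i" by (auto simp: r)
      have "h \<in> carrier GL" using simple_refl_in_GL[OF assms(1,2)] by (simp add: i r)
      moreover have "h \<otimes>\<^bsub>GL\<^esub> h = \<one>\<^bsub>GL\<^esub>" by (simp add: mult GL_one i)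
      ultimately have "inv\<^bsub>GL\<^esub> h = h" by (intro group.inv_equality[OF group_GL])
      then show ?case using D.r_in_W i by simp
    next
      case (eng h1 h2)
      then show ?case by (simp only: mult D.W_comp)
    qed
  next
    fix u assume "u \<in> D.W K"
    then obtain xs where xs: "set xs \<subseteq> K" "u = D.word xs" by (auto simp: D.W_def lists_eq_set)
    from xs(1) have "D.word xs \<in> generate GL (simple_refl \<alpha> \<alpha>v ` K)"
    proof (induction xs)
      case Nil
      show ?case by (simp only: D.word.simps generate.one flip: GL_one)
    next
      case (Cons i xs)
      from Cons.prems have "D.r i \<in> generate GL (simple_refl \<alpha> \<alpha>v ` K)"
        by (intro generate.incl) (simp add: r)
      moreover have "D.word xs \<in> generate GL (simple_refl \<alpha> \<alpha>v ` K)" using Cons by simp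
      ultimately have "D.r i \<otimes>\<^bsub>GL\<^esub> D.word xs \<in> generate GL (simple_refl \<alpha> \<alpha>v ` K)"
        by (rule generate.eng)
      then show ?case by (simp only: mult D.word.simps)
    qed
    then show "u \<in> parabolic \<alpha> \<alpha>v K" by (simp add: parabolic_def xs(2))
  qed
  have weyl: "weyl \<alpha> \<alpha>v = D.W UNIV" by (simp add: weyl_def W)
  have F: "face \<alpha> \<alpha>v \<mu> K = D.orbit_hull \<mu> K" for K
    by (simp add: face_def D.orbit_hull_def W)
  have dom: "0 \<le> blinfun_apply \<mu> (\<alpha>v i)" for i using assms(3) by (simp add: fundamental_chamber_def)
  have link: "D.linked \<mu> I"
    unfolding D.linked_def
  proof (intro allI impI subsetI)
    fix P i
    assume base: "\<forall>i\<in>I. blinfun_apply \<mu> (\<alpha>v i) \<noteq> 0 \<longrightarrow> i \<in> P"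
      and step: "\<forall>k\<in>I \<inter> P. \<forall>i\<in>I. blinfun_apply (\<alpha> k) (\<alpha>v i) \<noteq> 0 \<longrightarrow> i \<in> P" and "i \<in> I"
    from assms(4) \<open>i \<in> I\<close> show "i \<in> P"
    proof (induction rule: mu_connected_induct)
      fix i j
      assume "dynkin_adj \<alpha> \<alpha>v i j"
      then show "dynkin_adj \<alpha> \<alpha>v j i" unfolding dynkin_adj_def using D.c_zero[of i j] D.c_zero[of j i] by auto
    qed (use base step in \<open>auto simp: J0_def dynkin_adj_def\<close>)
  qed
  let ?S = "I_star \<alpha> \<alpha>v \<mu> I"
  \<comment> \<open>Orthogonality in one direction gives it in the other by \<open>D.c_zero\<close>,
    and then the two reflections commute.\<close>
  have star_sub: "J \<subseteq> ?S" if J: "\<And>j. j \<in> J \<Longrightarrow> blinfun_apply \<mu> (\<alpha>v j) = 0" "I \<inter> J = {}"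
    "\<And>i j. i \<in> I \<Longrightarrow> j \<in> J \<Longrightarrow> blinfun_apply (\<alpha> i) (\<alpha>v j) = 0" for J
  proof
    fix j assume j: "j \<in> J"
    have "D.r j \<circ> D.r i = D.r i \<circ> D.r j" if "i \<in> I" for i
    proof -
      have "blinfun_apply (\<alpha> i) (\<alpha>v j) = 0" using J(3)[OF that j] .
      moreover from this have "blinfun_apply (\<alpha> j) (\<alpha>v i) = 0" by (rule D.c_zero)
      ultimately show ?thesis by (intro ext) (simp add: D.r_def)
    qed
    then show "j \<in> ?S" using J(1)[OF j] J(2) j by (auto simp: I_star_def J0_def r)
  qed
  \<comment> \<open>Elements of \<open>D.W ?S\<close> commute with \<open>D.W I\<close> and fix
    \<open>\<mu>\<close>, so they fix the orbit of \<open>\<mu>\<close> under \<open>D.W I\<close>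
    pointwise.\<close>
  have star_fix: "s ` D.orbit_hull \<mu> I = D.orbit_hull \<mu> I" if "s \<in> D.W ?S" for s
  proof -
    have r_word: "D.r j \<circ> D.word xs = D.word xs \<circ> D.r j" if "j \<in> ?S" "set xs \<subseteq> I" for j xs
      using that(2)
    proof (induction xs)
      case (Cons i xs)
      have "D.r j \<circ> D.r i = D.r i \<circ> D.r j" using Cons.prems that(1) by (auto simp: I_star_def r)
      with Cons show ?case by (simp add: fun_eq_iff)
    qed simp
    have "D.word ys (D.word xs \<mu>) = D.word xs \<mu>" if "set ys \<subseteq> ?S" "set xs \<subseteq> I" for xs ys
      using that(1)
    proof (induction ys)
      case (Cons j ys)
      then have "D.word (j # ys) (D.word xs \<mu>) = (D.r j \<circ> D.word xs) \<mu>" by simp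
      also have "\<dots> = D.word xs (D.r j \<mu>)" using r_word[of j xs] Cons.prems that(2) by simp
      also have "D.r j \<mu> = \<mu>" using Cons.prems by (auto simp: D.r_def I_star_def J0_def)
      finally show ?case .
    qed simp
    then have "s (t \<mu>) = t \<mu>" if "t \<in> D.W I" for t
      using \<open>s \<in> D.W ?S\<close> that by (auto simp: D.W_def lists_eq_set)
    then have "s ` (\<lambda>t. t \<mu>) ` D.W I = (\<lambda>t. t \<mu>) ` D.W I" by (simp add: image_image)
    then show ?thesis
      using D.linear_W[OF that] by (simp add: D.orbit_hull_def convex_hull_linear_image)
  qed
  \<comment> \<open>Here \<open>v\<close> stands for the quotient of \<open>w'\<close> by
    \<open>w\<close> on the left. Both claims of the theorem reduce to this equivalence.\<close>
  have sub_iff: "D.orbit_hull \<mu> I \<subseteq> v ` D.orbit_hull \<mu> I' \<longleftrightarrow>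
      I \<subseteq> I' \<and> v \<in> D.W ?S <#>\<^bsub>GL\<^esub> D.W I'" if v: "v \<in> D.W UNIV" for v
  proof
    assume "D.orbit_hull \<mu> I \<subseteq> v ` D.orbit_hull \<mu> I'"
    from D.orbit_hull_subset[OF dom link v this] obtain J s t where *:
      "v = s \<circ> t" "s \<in> D.W J" "t \<in> D.W I'" "I \<subseteq> I'"
      "\<And>j. j \<in> J \<Longrightarrow> blinfun_apply \<mu> (\<alpha>v j) = 0" "I \<inter> J = {}"
      "\<And>i j. i \<in> I \<Longrightarrow> j \<in> J \<Longrightarrow> blinfun_apply (\<alpha> i) (\<alpha>v j) = 0"
      by blast
    have "J \<subseteq> ?S" using *(5-7) by (rule star_sub)
    with * D.W_mono[of J ?S] show "I \<subseteq> I' \<and> v \<in> D.W ?S <#>\<^bsub>GL\<^esub> D.W I'"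
      unfolding set_mult_def mult by blast
  next
    assume "I \<subseteq> I' \<and> v \<in> D.W ?S <#>\<^bsub>GL\<^esub> D.W I'"
    then obtain s t where *: "I \<subseteq> I'" "v = s \<circ> t" "s \<in> D.W ?S" "t \<in> D.W I'"
      unfolding set_mult_def mult by blast
    have "D.orbit_hull \<mu> I = s ` D.orbit_hull \<mu> I" using star_fix[OF *(3)] by simp
    also have "\<dots> \<subseteq> s ` t ` D.orbit_hull \<mu> I'"
      using D.orbit_hull_mono[OF *(1)] D.W_image_orbit_hull[OF *(4)] by (simp add: image_mono)
    finally show "D.orbit_hull \<mu> I \<subseteq> v ` D.orbit_hull \<mu> I'" by (simp add: *(2) image_comp)
  qed
  obtain u where u: "u \<in> D.W UNIV" "u \<circ> w = id" "w \<circ> u = id"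
    using D.W_inverse assms(6) weyl by metis
  have GL: "f \<in> carrier GL" if f: "f \<in> D.W UNIV" for f
  proof -
    obtain g where "g \<circ> f = id" "f \<circ> g = id" using D.W_inverse[OF f] .
    then have "bij f" by (rule o_bij)
    then show ?thesis using D.linear_W[OF f] by (simp add: GL_def)
  qed
  have "inv\<^bsub>GL\<^esub> w = u"
    using u(1,2) assms(6)
    by (intro group.inv_equality[OF group_GL] GL) (simp_all only: weyl mult GL_one)
  moreover have "w ` D.orbit_hull \<mu> I \<subseteq> w' ` D.orbit_hull \<mu> I' \<longleftrightarrow>
      D.orbit_hull \<mu> I \<subseteq> (u \<circ> w') ` D.orbit_hull \<mu> I'"
  proof -
    have "w' = w \<circ> (u \<circ> w')" using u(3) by (simp flip: comp_assoc)
    then have "w' ` D.orbit_hull \<mu> I' = w ` (u \<circ> w') ` D.orbit_hull \<mu> I'" by (metis image_comp)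
    then show ?thesis using D.inj_W[of w UNIV] assms(6) by (simp add: weyl inj_image_subset_iff)
  qed
  moreover have "u \<circ> w' \<in> D.W UNIV" using u(1) assms(7) by (auto simp: weyl intro: D.W_comp)
  ultimately have part1: "w ` D.orbit_hull \<mu> I \<subseteq> w' ` D.orbit_hull \<mu> I' \<longleftrightarrow>
      I \<subseteq> I' \<and> inv\<^bsub>GL\<^esub> w \<otimes>\<^bsub>GL\<^esub> w' \<in> D.W ?S <#>\<^bsub>GL\<^esub> D.W I'"
    using sub_iff[of "u \<circ> w'"] by (simp only: mult)
  have part2: "D.W ?S <#>\<^bsub>GL\<^esub> D.W I' = set_stabilizer \<alpha> \<alpha>v (D.orbit_hull \<mu> I) <#>\<^bsub>GL\<^esub>
      set_stabilizer \<alpha> \<alpha>v (D.orbit_hull \<mu> I')" (is "?L = ?R") if "I \<subseteq> I'"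
  proof
    have "D.W ?S \<subseteq> set_stabilizer \<alpha> \<alpha>v (D.orbit_hull \<mu> I)"
      "D.W I' \<subseteq> set_stabilizer \<alpha> \<alpha>v (D.orbit_hull \<mu> I')"
      unfolding set_stabilizer_def weyl
      using star_fix D.W_image_orbit_hull[of _ I'] D.W_mono[OF subset_UNIV] by blast+
    then show "?L \<subseteq> ?R" by (rule mono_set_mult)
  next
    \<comment> \<open>For \<open>s\<close> and \<open>t\<close> in the two stabilizers, the smaller
      hull equals its image under \<open>s\<close>, which lies in the image of the larger hull under
      \<open>s \<circ> t\<close>; so \<open>sub_iff\<close> applies to
      \<open>s \<circ> t\<close>.\<close>
    show "?R \<subseteq> ?L"
    proof
      fix v assume "v \<in> ?R"
      then obtain s t where st: "v = s \<circ> t" "s \<in> D.W UNIV" "t \<in> D.W UNIV"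
        "s ` D.orbit_hull \<mu> I = D.orbit_hull \<mu> I" "t ` D.orbit_hull \<mu> I' = D.orbit_hull \<mu> I'"
        unfolding set_mult_def mult set_stabilizer_def weyl by blast
      have "D.orbit_hull \<mu> I = s ` D.orbit_hull \<mu> I" using st(4) by simp
      also have "\<dots> \<subseteq> s ` t ` D.orbit_hull \<mu> I'"
        using D.orbit_hull_mono[OF that] st(5) by (simp add: image_mono)
      finally have "D.orbit_hull \<mu> I \<subseteq> v ` D.orbit_hull \<mu> I'" by (simp add: st(1) image_comp)
      then show "v \<in> ?L" using sub_iff[of v] st(1-3) D.W_comp by blast
    qed
  qed
  show ?thesis unfolding F W using part1 part2 by blast
qed

end
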